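(* Let $p>0$ be an integer, and let $T^p(n,k)$ ($n\ge 0$, $0\le k\le n$) be the integers defined in the context. Then the integers $T^p(n,k)$ can equivalently be defined, for $n\ge 0$ and $1-p\le k\le n$, by the initial conditions $$T^p(0,0)=1,\qquad T^p(n,n)=0\ \text{ for } n>0,\qquad T^p(n,-j)=0\ \text{ for } n\ge 0,\ j=1,\dots,p-1,$$ together with the recurrence, for $n>0$ and $0\le k<n$, $$T^p(n,k)=T^p(n-1,k)+\sum_{j=1}^{p-1}(-1)^{j-1}\binom{p-1}{j}\,T^p(n,k-j).$$ That is, the unique array indexed by $n\ge 0$, $1-p\le k\le n$ that satisfies these initial conditions and this recurrence agrees with the array $T^p(n,k)$ of the context for all $n\ge 0$, $0\le k\le n$.
   Context: For every integer $p>0$, the integers $T^p(n,k)$, for $n\ge 0$ and $0\le k\le n$, are defined by the initial conditions $T^p(0,0)=1$ and $T^p(n,n)=0$ for $n>0$, and by the recurrence, for $n>0$ and $0\le k<n$, $$T^p(n,k)=\sum_{j=0}^{k}\binom{k-j+p-2}{p-2}\,T^p(n-1,j).$$ Convention for $p=1$: $\binom{m-1}{-1}$ is understood to be $1$ if $m=0$ and $0$ if $m>0$, so that the recurrence reads $T^1(n,k)=T^1(n-1,k)$, giving $T^1(n,0)=1$ for $n>0$ and $T^1(n,k)=0$ for $k>0$. *)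

theory Defs
  imports Complex_Main
begin

(* binom(m + p - 2, p - 2); the case split implements the convention
   binom(m - 1, -1) = [m = 0] for p = 1, where subtraction on nat would truncate. *)
definition kernel_coeff :: "nat \<Rightarrow> nat \<Rightarrow> int" where
  "kernel_coeff p m =
     (if p = 1 then (if m = 0 then 1 else 0) else int ((m + p - 2) choose (p - 2)))"

(* Meaningful for p > 0 and k \<le> n only; entries with k > n are set to 0 by convention. *)
primrec T :: "nat \<Rightarrow> nat \<Rightarrow> nat \<Rightarrow> int" where
  "T p 0 k = (if k = 0 then 1 else 0)"
| "T p (Suc n) k = (if k \<le> n then (\<Sum>j=0..k. kernel_coeff p (k - j) * T p n j) else 0)"

lemma T_initial:
  "T p 0 0 = 1"
  "n > 0 \<Longrightarrow> T p n n = 0"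
  by (simp, cases n, simp_all)

lemma T_recurrence:
  "n > 0 \<Longrightarrow> k < n \<Longrightarrow> T p n k = (\<Sum>j=0..k. kernel_coeff p (k - j) * T p (n - 1) j)"
  by (cases n) simp_all

definition index_set :: "nat \<Rightarrow> (nat \<times> int) set" where
  "index_set p = {(n, k). 1 - int p \<le> k \<and> k \<le> int n}"

(* Arrays indexed by index_set p are total functions whose values elsewhere are irrelevant:
   the conditions below only mention entries at indices in index_set p. *)
definition extended_array :: "nat \<Rightarrow> (nat \<Rightarrow> int \<Rightarrow> int) \<Rightarrow> bool" where
  "extended_array p U \<longleftrightarrow>
     U 0 0 = 1 \<and>
     (\<forall>n>0. U n (int n) = 0) \<and>
     (\<forall>n. \<forall>j\<in>{1..p - 1}. U n (- int j) = 0) \<and>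
     (\<forall>n>0. \<forall>k. 0 \<le> k \<and> k < int n \<longrightarrow>
        U n k = U (n - 1) k +
          (\<Sum>j=1..p - 1. (-1) ^ (j - 1) * int ((p - 1) choose j) * U n (k - int j)))"

end

theory Submission
  imports Defs "HOL-Computational_Algebra.Formal_Power_Series"
begin

text \<open>
  For \<open>k < n\<close> the defining recurrence says that row \<open>n\<close> of \<open>T\<close> is the convolution of row
  \<open>n - 1\<close> with the coefficients of \<open>(1 - X)^-(p - 1)\<close>. Multiplying by \<open>(1 - X)^(p - 1)\<close> gives the
  second recurrence, and the latter determines an array row by row, each row from left to right.
\<close>

lemma fps_nth_one_minus_X_power:
  "fps_nth ((1 - fps_X) ^ q) n = (-1) ^ n * (of_nat (q choose n) :: 'a :: comm_ring_1)"
proof (induction q arbitrary: n)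
  case 0
  then show ?case by (cases n) auto
next
  case (Suc q)
  have "(1 - fps_X) ^ Suc q = (1 - fps_X) ^ q - fps_X * ((1 - fps_X) ^ q :: 'a fps)"
    by (simp add: algebra_simps)
  then show ?case
    by (cases n) (simp_all add: Suc algebra_simps)
qed

lemma kernel_coeff_Suc_Suc:
  "kernel_coeff (Suc (Suc q)) m = int ((m + q) choose q)"
  by (simp add: kernel_coeff_def)

text \<open>One factor \<open>1 - fps_X\<close> replaces coefficients by consecutive differences,
  and this lowers the parameter of \<open>kernel_coeff\<close> by one. After \<open>q\<close>
  factors only the indicator of 0 is left, which is the convention for p = 1.\<close>

lemma kernel_fps_inverse:
  "(1 - fps_X) ^ q * Abs_fps (kernel_coeff (Suc q)) = 1"
proof (induction q)
  case 0
  show ?case by (rule fps_ext) (simp add: kernel_coeff_def)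
next
  case (Suc q)
  have "(1 - fps_X) * Abs_fps (kernel_coeff (Suc (Suc q))) = Abs_fps (kernel_coeff (Suc q))"
  proof (rule fps_ext)
    fix n
    show "fps_nth ((1 - fps_X) * Abs_fps (kernel_coeff (Suc (Suc q)))) n =
        fps_nth (Abs_fps (kernel_coeff (Suc q))) n"
    \<comment> \<open>For \<open>q = 0\<close> the target is that indicator and the claim is the
      geometric series; for \<open>q = Suc r\<close> it is Pascal's rule.\<close>
    proof (cases q)
      case 0
      then show ?thesis
        by (cases n) (simp_all add: kernel_coeff_def left_diff_distrib)
    next
      case (Suc r)
      then show ?thesis
        by (cases n) (simp_all add: kernel_coeff_Suc_Suc left_diff_distrib)
    qed
  qed
  then have "(1 - fps_X) ^ Suc q * Abs_fps (kernel_coeff (Suc (Suc q))) =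
      (1 - fps_X) ^ q * Abs_fps (kernel_coeff (Suc q))"
    by (simp only: power_Suc2 mult.assoc)
  then show ?case using Suc by simp
qed

lemma T_alternating_sum:
  assumes "k \<le> n"
  shows "(\<Sum>j=0..k. (-1) ^ j * int (q choose j) * T (Suc q) (Suc n) (k - j)) = T (Suc q) n k"
proof -
  define K where "K = Abs_fps (kernel_coeff (Suc q))"
  define F where "F = Abs_fps (T (Suc q) n)"
  \<comment> \<open>The bound on \<open>i\<close> matters: row \<open>Suc n\<close> is cut off to 0
    beyond \<open>n\<close>, while the coefficients of \<open>K * F\<close> need not vanish
    there.\<close>
  have row: "T (Suc q) (Suc n) i = fps_nth (K * F) i" if "i \<le> n" for i
    unfolding mult.commute[of K F] fps_mult_nth using that by (simp add: K_def F_def mult.commute)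
  have "(1 - fps_X) ^ q * (K * F) = F"
    unfolding K_def mult.assoc[symmetric] kernel_fps_inverse by simp
  then have "T (Suc q) n k = fps_nth ((1 - fps_X) ^ q * (K * F)) k"
    by (simp only: F_def fps_nth_Abs_fps)
  also have "\<dots> = (\<Sum>j=0..k. (-1) ^ j * int (q choose j) * T (Suc q) (Suc n) (k - j))"
    unfolding fps_mult_nth[of "(1 - fps_X) ^ q"]
    using assms by (intro sum.cong) (simp_all add: fps_nth_one_minus_X_power row del: T.simps)
  finally show ?thesis by simp
qed

text \<open>Padding by zeros on the left meets the boundary conditions and lets the sum in the
  recurrence run to p - 1 for every k.\<close>

lemma extended_array_T:
  assumes "p > 0"
  shows "extended_array p (\<lambda>n k. if k < 0 then 0 else T p n (nat k))"
    (is "extended_array p ?U")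
proof -
  obtain q where p: "p = Suc q" using assms by (cases p) auto
  have "?U n k = ?U (n - 1) k +
      (\<Sum>j=1..p - 1. (-1) ^ (j - 1) * int ((p - 1) choose j) * ?U n (k - int j))"
    if n: "n > 0" and k: "0 \<le> k" "k < int n" for n k
  proof -
    obtain m where m: "n = Suc m" using n by (cases n) auto
    obtain i where i: "k = int i" using k nonneg_int_cases by blast
    define g where "g j = (-1) ^ j * int (q choose j) * ?U n (k - int j)" for j
    have "T p m i = (\<Sum>j=0..i. (-1) ^ j * int (q choose j) * T p n (i - j))"
      using T_alternating_sum[of i m q] k by (simp add: p m i del: T.simps)
    \<comment> \<open>Where the ranges differ the terms vanish: for j > q by the binomial
      coefficient, for j > i by the zero padding.\<close>
    also have "\<dots> = (\<Sum>j=0..q. g j)"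
      by (rule sum.mono_neutral_cong) (auto simp: g_def i nat_diff_distrib simp del: T.simps)
    \<comment> \<open>\<open>g 0\<close> is the entry to be solved for; moving the other terms
      across turns the sign exponent j into j - 1.\<close>
    also have "\<dots> = g 0 + (\<Sum>j=1..q. g j)"
      by (simp add: sum.atLeast_Suc_atMost)
    also have "(\<Sum>j=1..q. g j) =
        - (\<Sum>j=1..q. (-1) ^ (j - 1) * int (q choose j) * ?U n (k - int j))"
      unfolding sum_negf[symmetric]
    proof (rule sum.cong)
      fix j assume "j \<in> {1..q}"
      then have "(-1) ^ j = - ((-1) ^ (j - 1) :: int)" by (cases j) auto
      then show "g j = - ((-1) ^ (j - 1) * int (q choose j) * ?U n (k - int j))"
        by (simp add: g_def del: T.simps)
    qed simp
    finally show ?thesis by (simp add: g_def p m i del: T.simps)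
  qed
  then show ?thesis
    unfolding extended_array_def by (auto simp: T_initial(2) simp del: T.simps simp: T_initial(1))
qed

text \<open>Each entry with 0 \<le> k < n is fixed by the entry above it and the p - 1 entries to
  its left, so the induction runs over rows and, within a row, over columns.\<close>

lemma extended_array_unique:
  assumes U: "extended_array p U" and V: "extended_array p V"
    and "1 - int p \<le> k" "k \<le> int n"
  shows "U n k = V n k"
proof -
  have neg: "U n k = V n k" if "1 - int p \<le> k" "k < 0" for n k
  proof -
    have "nat (- k) \<in> {1..p - 1}" "k = - int (nat (- k))" using that by auto
    moreover have "W n (- int j) = 0" if "extended_array p W" "j \<in> {1..p - 1}" for W j
      using that unfolding extended_array_def by blast
    ultimately show ?thesis using U V by metis
  qed
  show ?thesis
    using assms(3,4)
  proof (induction n arbitrary: k)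
    case 0
    then show ?case
      using neg U V by (cases "k = 0") (auto simp: extended_array_def)
  next
    case (Suc n)
    \<comment> \<open>The shift by p keeps the measure positive on all columns k \<ge> 1 - p, so
      that it strictly drops at each step to the left, also into negative columns.\<close>
    from Suc.prems show ?case
    proof (induction "nat (k + int p)" arbitrary: k rule: less_induct)
      case less
      consider "k < 0" | "k = int (Suc n)" | "0 \<le> k" "k < int (Suc n)"
        using less.prems by linarith
      then show ?case
      proof cases
        case 1
        then show ?thesis using neg less.prems by simp
      next
        case 2
        have "W (Suc n) (int (Suc n)) = 0" if "extended_array p W" for W
          using that by (simp add: extended_array_def del: of_nat_Suc)
        from this[OF U] this[OF V] show ?thesis by (simp only: 2)
      next
        case 3
        have rec: "W (Suc n) k = W n k +
            (\<Sum>j=1..p - 1. (-1) ^ (j - 1) * int ((p - 1) choose j) * W (Suc n) (k - int j))"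
          if "extended_array p W" for W
        proof -
          have "\<forall>n>0. \<forall>k. 0 \<le> k \<and> k < int n \<longrightarrow> W n k = W (n - 1) k +
              (\<Sum>j=1..p - 1. (-1) ^ (j - 1) * int ((p - 1) choose j) * W n (k - int j))"
            using that unfolding extended_array_def by blast
          from this[rule_format, of "Suc n" k] 3 show ?thesis by simp
        qed
        have "U n k = V n k" using Suc.IH 3 less.prems by simp
        moreover have "U (Suc n) (k - int j) = V (Suc n) (k - int j)" if "j \<in> {1..p - 1}" for j
          using that 3 by (intro less.hyps) auto
        ultimately show ?thesis using rec[OF U] rec[OF V] by simp
      qed
    qed
  qed
qed

theorem proposition1:
  fixes p :: nat
  assumes "p > 0"
  shows "(\<exists>U. extended_array p U) \<and>
    (\<forall>U V. extended_array p U \<and> extended_array p V \<longrightarrow>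
       (\<forall>(n, k)\<in>index_set p. U n k = V n k)) \<and>
    (\<forall>U. extended_array p U \<longrightarrow> (\<forall>n k. k \<le> n \<longrightarrow> U n (int k) = T p n k))"
proof (intro conjI allI impI)
  show "\<exists>U. extended_array p U"
    using extended_array_T[OF assms] by blast
next
  fix U V assume "extended_array p U \<and> extended_array p V"
  then show "\<forall>(n, k)\<in>index_set p. U n k = V n k"
    using extended_array_unique unfolding index_set_def by blast
next
  fix U and n k :: nat
  assume "extended_array p U" "k \<le> n"
  \<comment> \<open>Uniqueness against the padded array, read at a column where the padding does not
    enter.\<close>
  then show "U n (int k) = T p n k"
    using extended_array_unique[OF _ extended_array_T[OF assms], of U "int k" n] assms by simp
qed

end
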